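(* Let $n$ be a positive integer and let $i,j$ be non-negative integers. Then $$f_{n+i+1}\, f^{(i+1)}_{n+j+1} = f_{n+i+j+2}\, f^{(i+1)}_{n} + (-1)^n\, w_{i+1}w_{i+2}\cdots w_{i+n}\, f_{i+1}\, f^{(n+i+1)}_{j+1}.$$
   Context: Let $(w_n)_{n\ge 0}$ be a sequence of commuting indeterminates (called weights). The weighted Fibonacci numbers $f_n$ ($n\ge 0$) are defined by $f_0=0$, $f_1=1$ and $f_{n+2}=f_{n+1}+w_n f_n$ for $n\ge 0$. For each integer $m\ge 0$, the weighted $m$-shifted Fibonacci numbers $f^{(m)}_n$ ($n\ge 0$) are defined by $f^{(m)}_0=0$, $f^{(m)}_1=1$ and $f^{(m)}_{n+2}=f^{(m)}_{n+1}+w_{n+m} f^{(m)}_n$ for $n\ge 0$. The superscript $(m)$ is an index, not a power or a derivative. Both are polynomials in the weights with integer coefficients. *)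

theory Defs
  imports "HOL-Library.Poly_Mapping"
begin

text \<open>
  The ring of polynomials with integer coefficients in countably many commuting
  indeterminates, as the monoid ring of the finitely supported exponent functions
  (multiplication is convolution).
\<close>
type_synonym weight_poly = "(nat \<Rightarrow>\<^sub>0 nat) \<Rightarrow>\<^sub>0 int"

definition weight :: "nat \<Rightarrow> weight_poly" where
  "weight n = Poly_Mapping.single (Poly_Mapping.single n 1) 1"

fun wfib :: "(nat \<Rightarrow> 'a::comm_ring_1) \<Rightarrow> nat \<Rightarrow> 'a" where
  "wfib w 0 = 0"
| "wfib w (Suc 0) = 1"
| "wfib w (Suc (Suc n)) = wfib w (Suc n) + w n * wfib w n"

fun shifted_wfib :: "(nat \<Rightarrow> 'a::comm_ring_1) \<Rightarrow> nat \<Rightarrow> nat \<Rightarrow> 'a" where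
  "shifted_wfib w m 0 = 0"
| "shifted_wfib w m (Suc 0) = 1"
| "shifted_wfib w m (Suc (Suc n)) =
     shifted_wfib w m (Suc n) + w (n + m) * shifted_wfib w m n"

end

theory Submission imports Defs begin

text \<open>
  For fixed \<open>n\<close> and \<open>i\<close>, the three terms of the identity, as functions of \<open>j\<close>, satisfy the same
  second-order recurrence, with coefficient \<open>w (n + i + j + 2)\<close>. It therefore suffices to check
  two consecutive values of \<open>j\<close>: the value \<open>j = -1\<close> is trivial, and \<open>j = 0\<close> is a Cassini-type
  identity.
\<close>

text \<open>As sequences in \<open>n\<close>, \<open>wfib w (n + i + 1)\<close> and
  \<open>shifted_wfib w (i + 1) n\<close> solve the same recurrence, so their Casoratian picks up a
  factor \<open>- w (n + i + 1)\<close> at each step, starting from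
  \<open>wfib w (i + 1)\<close>.\<close>

lemma wfib_cassini:
  fixes w :: "nat \<Rightarrow> 'a::comm_ring_1"
  shows "wfib w (n + i + 1) * shifted_wfib w (i + 1) (n + 1) =
    wfib w (n + i + 2) * shifted_wfib w (i + 1) n
    + (-1) ^ n * (\<Prod>k=1..n. w (i + k)) * wfib w (i + 1)"
proof (induction n)
  case 0
  show ?case by simp
next
  case (Suc n)
  let ?f = "wfib w" and ?g = "shifted_wfib w (i + 1)" and ?w = "w (n + i + 1)"
  let ?D = "(-1) ^ n * (\<Prod>k=1..n. w (i + k)) * ?f (i + 1)"
  have D: "(-1) ^ Suc n * (\<Prod>k=1..Suc n. w (i + k)) * ?f (i + 1) = - ?w * ?D"
    by (simp add: ac_simps)
  \<comment> \<open>Expanding \<open>?g (n + 2)\<close> and \<open>?f (n + i + 3)\<close>, the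
    common product \<open>?f (n + i + 2) * ?g (n + 1)\<close> cancels.\<close>
  have "?f (n + i + 2) * ?g (n + 2) - ?f (n + i + 3) * ?g (n + 1)
      = - ?w * (?f (n + i + 1) * ?g (n + 1) - ?f (n + i + 2) * ?g n)"
    by (simp add: numeral_2_eq_2 numeral_3_eq_3 algebra_simps)
  also have "\<dots> = - ?w * ?D"
    using Suc.IH by simp
  finally show ?case
    unfolding D by (simp add: numeral_2_eq_2 numeral_3_eq_3 algebra_simps)
qed

text \<open>Here \<open>j\<close> is one more than in the theorem, so the trivial value -1 becomes
  the base case 0.\<close>

lemma wfib_mult_shifted_wfib:
  fixes w :: "nat \<Rightarrow> 'a::comm_ring_1"
  shows "wfib w (n + i + 1) * shifted_wfib w (i + 1) (n + j) =
    wfib w (n + i + j + 1) * shifted_wfib w (i + 1) n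
    + (-1) ^ n * (\<Prod>k=1..n. w (i + k)) * wfib w (i + 1) * shifted_wfib w (n + i + 1) j"
proof (induction j rule: induct_nat_012)
  case 0
  show ?case by simp
next
  case 1
  show ?case using wfib_cassini[of w n i] by simp
next
  case (ge2 j)
  let ?f = "wfib w" and ?g = "shifted_wfib w (i + 1)" and ?h = "shifted_wfib w (n + i + 1)"
  let ?w = "w (n + i + j + 1)"
  let ?D = "(-1) ^ n * (\<Prod>k=1..n. w (i + k)) * ?f (i + 1)"
  \<comment> \<open>Index plus shift agree: (n + j) + (i + 1) = j + (n + i + 1), so all three
    recurrences carry the weight \<open>?w\<close>.\<close>
  have g: "?g (n + Suc (Suc j)) = ?g (n + Suc j) + ?w * ?g (n + j)"
    and f: "?f (n + i + Suc (Suc j) + 1) = ?f (n + i + Suc j + 1) + ?w * ?f (n + i + j + 1)"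
    and h: "?h (Suc (Suc j)) = ?h (Suc j) + ?w * ?h j"
    by (simp_all add: ac_simps)
  have "?f (n + i + 1) * ?g (n + Suc (Suc j))
      = ?f (n + i + 1) * ?g (n + Suc j) + ?w * (?f (n + i + 1) * ?g (n + j))"
    unfolding g by (simp only: algebra_simps)
  also have "\<dots> = (?f (n + i + Suc j + 1) * ?g n + ?D * ?h (Suc j))
      + ?w * (?f (n + i + j + 1) * ?g n + ?D * ?h j)"
    by (simp only: ge2.IH)
  also have "\<dots> = ?f (n + i + Suc (Suc j) + 1) * ?g n + ?D * ?h (Suc (Suc j))"
    unfolding f h by (simp only: algebra_simps)
  finally show ?case .
qed

theorem theorem4:
  fixes n i j :: nat
  assumes "n > 0"
  shows "wfib weight (n + i + 1) * shifted_wfib weight (i + 1) (n + j + 1) =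
    wfib weight (n + i + j + 2) * shifted_wfib weight (i + 1) n
    + (-1) ^ n * (\<Prod>k=1..n. weight (i + k))
      * wfib weight (i + 1) * shifted_wfib weight (n + i + 1) (j + 1)"
  using wfib_mult_shifted_wfib[of weight n i "j + 1"] by (simp add: add.assoc)

end
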